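(* Let $n\ge 1$ be an integer. Suppose $M:[0,\infty)\to[0,\infty)$ is a differentiable $N$-function satisfying the $\Delta_2$-condition and such that $M(r)/r^2$ is non-decreasing. Let $d\gamma_n(x)=e^{-|x|^2/2}\,dx$ on $\mathbb{R}^n$. Then there exist positive constants $C_1,C_2$ such that for every $u\in C_0^\infty(\mathbb{R}^n)$ $$\int_{\mathbb{R}^n}M(|\nabla u|)\,d\gamma_n\le C_1\int_{\mathbb{R}^n}M(|\nabla^{(2)}u|)\,d\gamma_n+C_2\int_{\mathbb{R}^n}M(|u|)\,d\gamma_n,$$ and there exist positive constants $\tilde C_1,\tilde C_2$ such that for every $u\in C_0^\infty(\mathbb{R}^n)$ $$\|\nabla u\|_{L^M(\mathbb{R}^n,\gamma_n)}\le \tilde C_1\sqrt{\|\nabla^{(2)}u\|_{L^M(\mathbb{R}^n,\gamma_n)}\,\|u\|_{L^M(\mathbb{R}^n,\gamma_n)}}+\tilde C_2\|u\|_{L^M(\mathbb{R}^n,\gamma_n)}.$$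
   Context: A function $M:[0,\infty)\to[0,\infty)$ is an $N$-function if it is convex, $M(0)=0$, $\lim_{r\to0^+}M(r)/r=0$ and $\lim_{r\to\infty}M(r)/r=\infty$. It satisfies the $\Delta_2$-condition if there is $C_M>1$ such that $M(2r)\le C_M M(r)$ for all $r>0$. $C_0^\infty(\mathbb{R}^n)$ is the set of smooth compactly supported functions on $\mathbb{R}^n$. $\nabla^{(2)}u$ is the Hessian matrix $[\partial^2u/\partial x_i\partial x_j]_{i,j=1}^n$, and $|A|=(\sum_{i,j}a_{ij}^2)^{1/2}$ is the Hilbert-Schmidt norm of a matrix $A$; $|\nabla u|$ is the Euclidean norm. For a measure $\mu$ on $\mathbb{R}^n$, the Luxemburg norm is $\|f\|_{L^M(\mathbb{R}^n,\mu)}=\inf\{K>0:\int_{\mathbb{R}^n}M(|f(x)|/K)\,d\mu(x)\le1\}$ (with $|f(x)|$ the Euclidean or Hilbert-Schmidt norm for vector- or matrix-valued $f$). *)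

theory Defs
  imports "HOL-Analysis.Analysis"
begin

text \<open>
  A function on \<open>[0,\<infinity>)\<close> is represented by a total function on the reals of which only the
  values on \<open>{0..}\<close> are used.
\<close>

definition N_function :: "(real \<Rightarrow> real) \<Rightarrow> bool" where
  "N_function M \<longleftrightarrow>
     (\<forall>r\<ge>0. 0 \<le> M r) \<and>
     convex_on {0..} M \<and>
     M 0 = 0 \<and>
     ((\<lambda>r. M r / r) \<longlongrightarrow> 0) (at_right 0) \<and>
     filterlim (\<lambda>r. M r / r) at_top at_top"

definition Delta2 :: "(real \<Rightarrow> real) \<Rightarrow> bool" where
  "Delta2 M \<longleftrightarrow> (\<exists>C>1. \<forall>r>0. M (2 * r) \<le> C * M r)"

definition partial_deriv :: "'n::finite \<Rightarrow> (real ^ 'n \<Rightarrow> real) \<Rightarrow> real ^ 'n \<Rightarrow> real" where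
  "partial_deriv i u x = deriv (\<lambda>t. u (x + t *\<^sub>R axis i 1)) 0"

text \<open>
  Smoothness: all iterated partial derivatives are (Frechet) differentiable everywhere. The empty
  index list covers the function itself; differentiability at each order guarantees that the
  partial derivatives of the next order exist, so no default value of \<^const>\<open>deriv\<close> enters.
\<close>

definition smooth :: "(real ^ 'n::finite \<Rightarrow> real) \<Rightarrow> bool" where
  "smooth u \<longleftrightarrow> (\<forall>js. foldr partial_deriv js u differentiable_on UNIV)"

definition test_functions :: "(real ^ 'n::finite \<Rightarrow> real) set" where
  "test_functions = {u. smooth u \<and> compact (closure {x. u x \<noteq> 0})}"

definition gradient :: "(real ^ 'n::finite \<Rightarrow> real) \<Rightarrow> real ^ 'n \<Rightarrow> real ^ 'n" where
  "gradient u x = (\<chi> i. partial_deriv i u x)"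

definition hessian :: "(real ^ 'n::finite \<Rightarrow> real) \<Rightarrow> real ^ 'n \<Rightarrow> real ^ 'n ^ 'n" where
  "hessian u x = (\<chi> i j. partial_deriv i (partial_deriv j u) x)"

text \<open>The library norm on matrices is the Hilbert-Schmidt norm.\<close>

lemma norm_matrix_eq_Hilbert_Schmidt:
  fixes A :: "real ^ 'n::finite ^ 'm::finite"
  shows "norm A = sqrt (\<Sum>i\<in>UNIV. \<Sum>j\<in>UNIV. (A $ i $ j)\<^sup>2)"
  by (simp add: norm_vec_def L2_set_def sum_nonneg)

text \<open>The Gaussian measure is not normalised.\<close>

definition gauss_measure :: "(real ^ 'n::finite) measure" where
  "gauss_measure = density lborel (\<lambda>x. ennreal (exp (- (norm x)\<^sup>2 / 2)))"

definition modular :: "(real \<Rightarrow> real) \<Rightarrow> 'a measure \<Rightarrow> ('a \<Rightarrow> 'b::real_normed_vector) \<Rightarrow> ennreal" where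
  "modular M \<mu> f = (\<integral>\<^sup>+ x. ennreal (M (norm (f x))) \<partial>\<mu>)"

text \<open>
  The infimum is taken in the reals, so the value is meaningful only if the set is nonempty. This
  holds whenever \<open>M\<close> is an N-function and \<open>f\<close> is measurable with finite modular, because
  \<open>M (r / K) \<le> M r / K\<close> for \<open>K \<ge> 1\<close>; in particular for test functions, their gradients and Hessians.
\<close>

definition luxemburg_norm :: "(real \<Rightarrow> real) \<Rightarrow> 'a measure \<Rightarrow> ('a \<Rightarrow> 'b::real_normed_vector) \<Rightarrow> real" where
  "luxemburg_norm M \<mu> f = Inf {K. K > 0 \<and> (\<integral>\<^sup>+ x. ennreal (M (norm (f x) / K)) \<partial>\<mu>) \<le> 1}"

end

theory Submission
  imports Defs
begin

text \<open>
  The gradient is controlled one line at a time. Along a coordinate direction, integrating by parts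
  against a cubic on a segment of length \<open>t\<close> starting at \<open>x\<close> bounds \<open>\<bar>\<partial>\<^sub>i u x\<bar>\<close> by the average over that
  segment of \<open>t * \<bar>\<partial>\<^sub>i\<^sub>i u\<bar> + (6 / t) * \<bar>u\<bar>\<close> (\<open>hermite_derivative_bound\<close>). Jensen's inequality carries
  this bound through \<open>M\<close> (\<open>partial_deriv_pointwise\<close>).

  The Gaussian weight costs only a constant factor, because the segment may be chosen to run from \<open>x\<close>
  towards the hyperplane \<open>x\<^sub>i = 0\<close>: for \<open>t \<le> 1\<close> the weight at \<open>x\<close> is then at most twice the weight at
  any point of the segment (\<open>gauss_weight_inward\<close>). Integrating over \<open>x\<close>, Tonelli's theorem and
  translation invariance of Lebesgue measure remove the average (\<open>partial_deriv_gauss_modular\<close>).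
  Summing over the directions gives, for \<open>c \<ge> 0\<close> and \<open>0 < t \<le> 1\<close>,
  \<open>\<integral> M (c * \<bar>\<nabla>u\<bar>) d\<gamma> \<le> 4 * \<integral> M (c * n * (t * \<bar>\<nabla>\<^sup>2 u\<bar> + (6 / t) * \<bar>u\<bar>)) d\<gamma>\<close> (\<open>gradient_gauss_modular\<close>).

  The modular inequality is the case \<open>c = t = 1\<close>: convexity separates the two terms and the doubling
  condition absorbs the constants inside \<open>M\<close>. For the norms, \<open>c\<close> is the reciprocal of the candidate
  norm, and convexity absorbs the factor \<open>4\<close>, which yields
  \<open>\<parallel>\<nabla>u\<parallel> \<le> 24 * n * (t * \<parallel>\<nabla>\<^sup>2 u\<parallel> + \<parallel>u\<parallel> / t)\<close>. The best \<open>t\<close> is the square root of \<open>\<parallel>u\<parallel> / \<parallel>\<nabla>\<^sup>2 u\<parallel>\<close>;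
  when this exceeds \<open>1\<close>, the choice \<open>t = 1\<close> produces the term in \<open>\<parallel>u\<parallel>\<close> alone
  (\<open>optimise_interpolation\<close>).
\<close>

section \<open>A one-dimensional derivative estimate\<close>

text \<open>
  The cubic \<open>\<phi>\<close> below satisfies \<open>\<phi> 0 = -1\<close>, \<open>\<phi> 1 = 0\<close> and has zero slope at both ends, so in
  \<open>\<integral> (f'' \<phi> - f \<phi>'')\<close>, the integral of the derivative of \<open>f' \<phi> - f \<phi>'\<close>, the only boundary term is \<open>f' 0\<close>.
\<close>

lemma hermite_derivative_bound:
  fixes f f' f'' :: "real \<Rightarrow> real"
  assumes f: "\<And>s. (f has_real_derivative f' s) (at s)"
    and f': "\<And>s. (f' has_real_derivative f'' s) (at s)"
    and f'': "continuous_on UNIV f''"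
  shows "\<bar>f' 0\<bar> \<le> integral {0..1} (\<lambda>s. \<bar>f'' s\<bar> + 6 * \<bar>f s\<bar>)"
proof -
  define \<phi> :: "real \<Rightarrow> real" where "\<phi> s = 3 * s ^ 2 - 2 * s ^ 3 - 1" for s
  define F where "F s = f' s * \<phi> s - f s * (6 * s - 6 * s ^ 2)" for s
  define G where "G s = f'' s * \<phi> s - f s * (6 - 12 * s)" for s
  have "(F has_real_derivative G s) (at s)" for s
    unfolding F_def G_def \<phi>_def
    by (rule derivative_eq_intros f f' refl | simp add: algebra_simps)+
  then have int: "(G has_integral F 1 - F 0) {0..1}"
    by (intro fundamental_theorem_of_calculus)
       (auto simp: has_real_derivative_iff_has_vector_derivative[symmetric]
             intro: has_field_derivative_at_within)
  have F: "F 1 - F 0 = f' 0"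
    by (simp add: F_def \<phi>_def)
  have cf: "continuous_on UNIV f"
    using f by (meson DERIV_continuous_on has_field_derivative_at_within)
  have bound: "\<bar>G s\<bar> \<le> \<bar>f'' s\<bar> + 6 * \<bar>f s\<bar>" if "s \<in> {0..1}" for s
  proof -
    have s: "0 \<le> s" "s \<le> 1"
      using that by auto
    have "0 \<le> s ^ 2 * (3 - 2 * s)"
      using s by simp
    \<comment> \<open>These two products are \<open>1 + \<phi> s\<close> and \<open>- \<phi> s\<close>.\<close>
    moreover have "0 \<le> (1 - s) ^ 2 * (1 + 2 * s)"
      using s by simp
    ultimately have "\<bar>\<phi> s\<bar> \<le> 1"
      unfolding \<phi>_def by (simp add: abs_le_iff power2_eq_square power3_eq_cube algebra_simps)
    then have 1: "\<bar>f'' s * \<phi> s\<bar> \<le> \<bar>f'' s\<bar>"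
      by (simp add: abs_mult mult_left_le)
    have "\<bar>6 - 12 * s\<bar> \<le> 6"
      using s by (simp add: abs_le_iff)
    from mult_left_mono[OF this, of "\<bar>f s\<bar>"] have 2: "\<bar>f s * (6 - 12 * s)\<bar> \<le> 6 * \<bar>f s\<bar>"
      by (simp add: abs_mult)
    from 1 2 show ?thesis
      unfolding G_def by linarith
  qed
  have "norm (integral {0..1} G) \<le> integral {0..1} (\<lambda>s. \<bar>f'' s\<bar> + 6 * \<bar>f s\<bar>)"
    using int bound
    by (intro integral_norm_bound_integral has_integral_integrable[OF int] integrable_continuous_interval)
       (auto intro!: continuous_intros continuous_on_subset[OF f''] continuous_on_subset[OF cf])
  then show ?thesis
    using integral_unique[OF int] F by simp
qed

lemma nn_integral_unit_interval:
  fixes g :: "real \<Rightarrow> real"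
  assumes "continuous_on UNIV g" and "\<And>s. 0 \<le> g s"
  shows "(\<integral>\<^sup>+ s. indicator {0..1} s * ennreal (g s) \<partial>lborel) = ennreal (integral {0..1} g)"
proof -
  have "(g has_integral integral {0..1} g) {0..1}"
    by (intro integrable_integral integrable_continuous_interval continuous_on_subset[OF assms(1)]) auto
  moreover have "g \<in> borel_measurable borel"
    using assms(1) by (rule borel_measurable_continuous_onI)
  moreover have "(\<lambda>s. indicator {0..1} s * g s) = (\<lambda>s. if s \<in> {0..1} then g s else 0)"
    by auto
  ultimately have "(\<integral>\<^sup>+ s. ennreal (indicator {0..1} s * g s) \<partial>lborel) = ennreal (integral {0..1} g)"
    using assms(2)
    by (intro nn_integral_has_integral_lborel[where f = "\<lambda>s. indicator {0..1} s * g s"])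
       (simp_all add: has_integral_restrict_UNIV del: atLeastAtMost_iff)
  moreover have "ennreal (indicator {0..1} s * g s) = indicator {0..1} s * ennreal (g s)" for s :: real
    by (simp add: indicator_def)
  ultimately show ?thesis
    by simp
qed

section \<open>Convex gauges and Jensen's inequality\<close>

locale young_gauge =
  fixes M :: "real \<Rightarrow> real"
  assumes nonneg: "\<And>r. 0 \<le> r \<Longrightarrow> 0 \<le> M r"
    and convex: "convex_on {0..} M"
    and zero: "M 0 = 0"
begin

lemma shrink:
  assumes "0 \<le> l" "l \<le> 1" "0 \<le> r"
  shows "M (l * r) \<le> l * M r"
  using convex_onD[OF convex, of l 0 r] assms zero by simp

lemma mono:
  assumes "0 \<le> r" "r \<le> s"
  shows "M r \<le> M s"
proof (cases "s = 0")
  case False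
  then have s: "0 < s"
    using assms by simp
  have "M r = M (r / s * s)"
    using s by simp
  also have "\<dots> \<le> r / s * M s"
    using s assms by (intro shrink) auto
  also have "\<dots> \<le> M s"
    using s assms nonneg[of s] by (intro mult_left_le_one_le) auto
  finally show ?thesis .
qed (use assms in auto)

text \<open>
  Extending evenly to the whole line turns boundary questions at \<open>0\<close> into interior ones: continuity
  (hence measurability) and supporting lines are then available at every point.
\<close>

lemma convex_even_extension: "convex_on UNIV (\<lambda>r. M \<bar>r\<bar>)"
proof (rule convex_onI)
  fix t x y :: real
  assume t: "0 < t" "t < 1"
  have "\<bar>(1 - t) *\<^sub>R x + t *\<^sub>R y\<bar> \<le> (1 - t) * \<bar>x\<bar> + t * \<bar>y\<bar>"
    using t by (simp add: order_trans[OF abs_triangle_ineq] abs_mult)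
  then have "M \<bar>(1 - t) *\<^sub>R x + t *\<^sub>R y\<bar> \<le> M ((1 - t) * \<bar>x\<bar> + t * \<bar>y\<bar>)"
    by (intro mono) auto
  also have "\<dots> \<le> (1 - t) * M \<bar>x\<bar> + t * M \<bar>y\<bar>"
    using convex_onD[OF convex, of t "\<bar>x\<bar>" "\<bar>y\<bar>"] t by simp
  finally show "M \<bar>(1 - t) *\<^sub>R x + t *\<^sub>R y\<bar> \<le> (1 - t) * M \<bar>x\<bar> + t * M \<bar>y\<bar>" .
qed simp

lemma continuous_even_extension: "continuous_on UNIV (\<lambda>r. M \<bar>r\<bar>)"
  using convex_even_extension by (intro convex_on_continuous) auto

lemma continuous_comp:
  assumes "continuous_on UNIV h" and "\<And>x. 0 \<le> h x"
  shows "continuous_on UNIV (\<lambda>x. M (h x))"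
proof -
  have "continuous_on UNIV (\<lambda>x. M \<bar>h x\<bar>)"
    using continuous_on_compose2[OF continuous_even_extension assms(1)] by simp
  then show ?thesis
    using assms(2) by simp
qed

lemma measurable_comp:
  assumes "continuous_on UNIV h" and "\<And>x. 0 \<le> h x"
  shows "(\<lambda>x. M (h x)) \<in> borel_measurable borel"
  using continuous_comp[OF assms] by (rule borel_measurable_continuous_onI)

text \<open>
  Jensen's inequality by integrating the supporting line of the even extension at the mean value
  \<open>m\<close> of \<open>g\<close>.
\<close>

lemma jensen_unit_interval:
  fixes g :: "real \<Rightarrow> real"
  assumes g: "continuous_on UNIV g" "\<And>s. 0 \<le> g s"
    and a: "0 \<le> a" "a \<le> integral {0..1} g"
  shows "ennreal (M a) \<le> (\<integral>\<^sup>+ s. indicator {0..1} s * ennreal (M (g s)) \<partial>lborel)"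
proof -
  define m where "m = integral {0..1} g"
  define k where "k = Inf ((\<lambda>t. (M \<bar>m\<bar> - M \<bar>t\<bar>) / (m - t)) ` ({m<..} \<inter> UNIV))"
  have m: "0 \<le> m"
    using a by (simp add: m_def)
  have tangent: "M m + k * (g s - m) \<le> M (g s)" for s
    using convex_le_Inf_differential[OF convex_even_extension, of m "g s"] g(2)[of s] m
    by (simp add: k_def)
  have ig: "g integrable_on {0..1}"
    by (intro integrable_continuous_interval continuous_on_subset[OF g(1)]) auto
  have "((\<lambda>s. M m + k * (g s - m)) has_integral (M m + k * (m - m))) {0..1}"
    using ig unfolding m_def
    by (intro has_integral_add has_integral_mult_right has_integral_diff integrable_integral)
       (use has_integral_const_real[of _ 0 1] in auto)
  moreover have "((\<lambda>s. M (g s)) has_integral integral {0..1} (\<lambda>s. M (g s))) {0..1}"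
    by (intro integrable_integral integrable_continuous_interval
          continuous_on_subset[OF continuous_comp[OF g]]) auto
  ultimately have "M m + k * (m - m) \<le> integral {0..1} (\<lambda>s. M (g s))"
    using tangent by (rule has_integral_le)
  moreover have "M a \<le> M m"
    using a by (intro mono) (auto simp: m_def)
  ultimately show ?thesis
    using nn_integral_unit_interval[OF continuous_comp[OF g]] nonneg g(2)
    by (simp add: ennreal_leI)
qed

end

section \<open>Derivatives of test functions\<close>

lemma test_function_partials:
  assumes "u \<in> test_functions"
  shows "foldr partial_deriv js u differentiable_on UNIV"
    and "continuous_on UNIV (foldr partial_deriv js u)"
  using assms by (auto simp: test_functions_def smooth_def intro: differentiable_imp_continuous_on)

lemma partial_deriv_along_line:
  assumes "v differentiable_on UNIV"
  shows "((\<lambda>s. v (x + (s * c) *\<^sub>R axis i 1)) has_real_derivative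
            c * partial_deriv i v (x + (s * c) *\<^sub>R axis i 1)) (at s)"
proof -
  have d: "(v has_derivative frechet_derivative v (at y)) (at y)" for y
    using assms by (simp add: differentiable_on_def flip: frechet_derivative_works)
  have line: "((\<lambda>s. v (y + (s * c) *\<^sub>R axis i 1)) has_real_derivative
      c * frechet_derivative v (at (y + (s * c) *\<^sub>R axis i 1)) (axis i 1)) (at s)" for y s c
  proof -
    have "((\<lambda>s. y + (s * c) *\<^sub>R axis i 1) has_derivative (\<lambda>h. (h * c) *\<^sub>R axis i 1)) (at s)"
      by (auto intro!: derivative_eq_intros)
    from has_derivative_compose[OF this d]
    have "((\<lambda>s. v (y + (s * c) *\<^sub>R axis i 1)) has_derivative
        (\<lambda>h. frechet_derivative v (at (y + (s * c) *\<^sub>R axis i 1)) ((h * c) *\<^sub>R axis i 1))) (at s)" .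
    then show ?thesis
      using linear_scale[OF has_derivative_linear[OF d]]
      by (simp add: has_field_derivative_def mult_ac mult_commute_abs)
  qed
  have "partial_deriv i v y = frechet_derivative v (at y) (axis i 1)" for y
    unfolding partial_deriv_def using line[of y 1 0] by (intro DERIV_imp_deriv) simp
  then show ?thesis
    using line by simp
qed

text \<open>
  A derivative sees only the values nearby, so by induction on the order all partial derivatives
  of a function vanish off its closed support.
\<close>

lemma partial_deriv_eq_0_on_open:
  assumes "open U" "\<And>y. y \<in> U \<Longrightarrow> v y = 0" "x \<in> U"
  shows "partial_deriv i v x = 0"
proof -
  have "((\<lambda>t. x + t *\<^sub>R axis i 1) \<longlongrightarrow> x + 0 *\<^sub>R axis i 1) (nhds (0::real))"
    by (intro tendsto_intros filterlim_ident)
  then have "eventually (\<lambda>t. x + t *\<^sub>R axis i 1 \<in> U) (nhds (0::real))"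
    using assms(1,3) by (auto dest: topological_tendstoD)
  then have "eventually (\<lambda>t. v (x + t *\<^sub>R axis i 1) = 0) (nhds 0)"
    by eventually_elim (rule assms(2))
  then have "deriv (\<lambda>t. v (x + t *\<^sub>R axis i 1)) 0 = deriv (\<lambda>_. 0) 0"
    by (rule deriv_cong_ev) simp
  then show ?thesis
    by (simp add: partial_deriv_def)
qed

lemma test_function_partials_support:
  assumes "x \<notin> closure {x. u x \<noteq> 0}"
  shows "foldr partial_deriv js u x = 0"
  using assms
proof (induction js arbitrary: x)
  case Nil
  then show ?case
    using closure_subset[of "{x. u x \<noteq> 0}"] by auto
next
  case (Cons i js)
  then show ?case
    by (auto intro: partial_deriv_eq_0_on_open[of "- closure {x. u x \<noteq> 0}"])
qed

lemma test_function_derivs_support: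
  assumes "x \<notin> closure {x. u x \<noteq> 0}"
  shows "u x = 0" "gradient u x = 0" "hessian u x = 0"
  using test_function_partials_support[OF assms, of "[]"]
    test_function_partials_support[OF assms, of "[_]"]
    test_function_partials_support[OF assms, of "[_, _]"]
  by (simp_all add: gradient_def hessian_def vec_eq_iff)

lemma norm_hessian_ge: "\<bar>partial_deriv i (partial_deriv i u) x\<bar> \<le> norm (hessian u x)"
proof -
  have "\<bar>hessian u x $ i $ i\<bar> \<le> norm (hessian u x $ i)"
    by (rule component_le_norm_cart)
  also have "\<dots> \<le> norm (hessian u x)"
    by (rule Finite_Cartesian_Product.norm_nth_le)
  finally show ?thesis
    by (simp add: hessian_def)
qed

lemma continuous_hessian: "u \<in> test_functions \<Longrightarrow> continuous_on UNIV (hessian u)"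
  using test_function_partials(2)[of u "[_, _]"]
  unfolding hessian_def by (auto intro!: continuous_intros)

section \<open>The Gaussian weight and averages over segments\<close>

lemma nn_integral_gauss_measure:
  fixes f :: "real ^ 'n::finite \<Rightarrow> ennreal"
  assumes "f \<in> borel_measurable borel"
  shows "(\<integral>\<^sup>+ x. f x \<partial>gauss_measure) = (\<integral>\<^sup>+ x. f x * ennreal (exp (- (norm x)\<^sup>2 / 2)) \<partial>lborel)"
  unfolding gauss_measure_def using assms
  by (subst nn_integral_density) (auto simp: mult.commute)

text \<open>
  With \<open>\<sigma>\<close> opposite in sign to \<open>x $ i\<close>, the step changes \<open>\<bar>x\<bar>\<^sup>2\<close> by \<open>- 2 * \<tau> * \<bar>x $ i\<bar> + \<tau>\<^sup>2 \<le> 1\<close>. The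
  loss in the weight is thus at most \<open>exp (1 / 2) \<le> 2\<close>, uniformly in \<open>x\<close>, although the Gaussian weight
  is not comparable on unit segments pointing outwards.
\<close>

lemma gauss_weight_inward:
  fixes x :: "real ^ 'n::finite"
  assumes "0 \<le> \<tau>" "\<tau> \<le> 1" "\<sigma> = (if 0 \<le> x $ i then - 1 else 1)"
  shows "exp (- (norm x)\<^sup>2 / 2) \<le> 2 * exp (- (norm (x + (\<tau> * \<sigma>) *\<^sub>R axis i 1))\<^sup>2 / 2)"
proof -
  let ?y = "x + (\<tau> * \<sigma>) *\<^sub>R axis i 1"
  have "(norm ?y)\<^sup>2 = (norm x)\<^sup>2 + 2 * (\<tau> * \<sigma> * x $ i) + (\<tau> * \<sigma>)\<^sup>2"
    unfolding power2_norm_eq_inner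
    by (simp add: inner_add_left inner_add_right inner_axis inner_commute inner_axis_axis
        power2_eq_square algebra_simps)
  moreover have "\<tau> * \<sigma> * x $ i \<le> 0"
    using assms by (auto simp: mult_nonneg_nonpos)
  moreover have "(\<tau> * \<sigma>)\<^sup>2 \<le> 1"
    using assms by (auto simp: power_mult_distrib abs_square_le_1)
  ultimately have "- (norm x)\<^sup>2 / 2 \<le> 1 / 2 + - (norm ?y)\<^sup>2 / 2"
    by argo
  then have "exp (- (norm x)\<^sup>2 / 2) \<le> exp (1 / 2) * exp (- (norm ?y)\<^sup>2 / 2)"
    by (simp flip: exp_add)
  moreover have "exp (1 / 2 :: real) \<le> 2"
  proof (rule power2_le_imp_le)
    have "(exp (1 / 2 :: real))\<^sup>2 = exp 1"
      by (simp flip: exp_double)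
    then show "(exp (1 / 2 :: real))\<^sup>2 \<le> 2\<^sup>2"
      using exp_le by simp
  qed simp
  ultimately show ?thesis
    by (meson exp_ge_zero mult_right_mono order_trans)
qed

lemma nn_integral_lborel_translate:
  fixes G :: "'a::euclidean_space \<Rightarrow> ennreal"
  assumes "G \<in> borel_measurable borel"
  shows "(\<integral>\<^sup>+ x. G (x + c) \<partial>lborel) = (\<integral>\<^sup>+ x. G x \<partial>lborel)"
proof -
  have "(\<integral>\<^sup>+ x. G x \<partial>lborel) = (\<integral>\<^sup>+ x. G x \<partial>distr lborel borel ((+) c))"
    by (simp add: lborel_distr_plus)
  also have "\<dots> = (\<integral>\<^sup>+ x. G (x + c) \<partial>lborel)"
    using assms by (subst nn_integral_distr) (auto simp: add.commute)
  finally show ?thesis ..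
qed

lemma nn_integral_translation_average:
  fixes G :: "'a::euclidean_space \<Rightarrow> ennreal"
  assumes [measurable]: "G \<in> borel_measurable borel"
  shows "(\<integral>\<^sup>+ x. \<integral>\<^sup>+ s. indicator {0..1::real} s * G (x + s *\<^sub>R e) \<partial>lborel \<partial>lborel)
    = (\<integral>\<^sup>+ x. G x \<partial>lborel)"
proof -
  have "(\<integral>\<^sup>+ x. \<integral>\<^sup>+ s. indicator {0..1::real} s * G (x + s *\<^sub>R e) \<partial>lborel \<partial>lborel)
      = (\<integral>\<^sup>+ s. \<integral>\<^sup>+ x. indicator {0..1::real} s * G (x + s *\<^sub>R e) \<partial>lborel \<partial>lborel)"
    by (rule lborel_pair.Fubini') measurable
  also have "\<dots> = (\<integral>\<^sup>+ s. indicator {0..1::real} s * (\<integral>\<^sup>+ x. G x \<partial>lborel) \<partial>lborel)"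
    by (intro nn_integral_cong) (simp add: nn_integral_cmult nn_integral_lborel_translate)
  also have "\<dots> = (\<integral>\<^sup>+ x. G x \<partial>lborel)"
    by (simp add: nn_integral_multc)
  finally show ?thesis .
qed

section \<open>The weighted gradient estimate with a free scale\<close>

context young_gauge
begin

text \<open>
  Here \<open>\<sigma> = \<plusminus> 1\<close> is the orientation of the segment, to be chosen according to the sign of \<open>x $ i\<close>. The
  factor \<open>c\<close> serves to apply the estimate to \<open>M (\<cdot> / K)\<close>.
\<close>

lemma partial_deriv_pointwise:
  fixes u :: "real ^ 'n::finite \<Rightarrow> real" and i :: 'n
  assumes u: "u \<in> test_functions" and t: "0 < t" "\<bar>\<sigma>\<bar> = 1" and c: "0 \<le> c"
  defines "h \<equiv> \<lambda>x. c * (t * \<bar>partial_deriv i (partial_deriv i u) x\<bar> + 6 / t * \<bar>u x\<bar>)"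
  shows "ennreal (M (c * \<bar>partial_deriv i u x\<bar>))
    \<le> (\<integral>\<^sup>+ s. indicator {0..1} s * ennreal (M (h (x + (s * (t * \<sigma>)) *\<^sub>R axis i 1))) \<partial>lborel)"
proof (rule jensen_unit_interval)
  let ?l = "\<lambda>s. x + (s * (t * \<sigma>)) *\<^sub>R axis i 1"
  let ?p = "partial_deriv i u" and ?q = "partial_deriv i (partial_deriv i u)"
  have diff: "u differentiable_on UNIV" "?p differentiable_on UNIV"
    and cont: "continuous_on UNIV u" "continuous_on UNIV ?q"
    using test_function_partials[OF u, of "[]"] test_function_partials[OF u, of "[i]"]
      test_function_partials[OF u, of "[i, i]"] by auto
  have cl: "continuous_on UNIV ?l"
    by (intro continuous_intros)
  have ct: "continuous_on UNIV (\<lambda>s. u (?l s))" "continuous_on UNIV (\<lambda>s. ?q (?l s))"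
    using continuous_on_compose2[OF cont(1) cl] continuous_on_compose2[OF cont(2) cl] by auto
  show "continuous_on UNIV (\<lambda>s. h (?l s))"
    unfolding h_def by (intro continuous_intros ct)
  show "0 \<le> h (?l s)" for s
    using t c by (simp add: h_def)
  show "0 \<le> c * \<bar>?p x\<bar>"
    using c by simp
  have "\<bar>t * \<sigma> * ?p (?l 0)\<bar>
      \<le> integral {0..1} (\<lambda>s. \<bar>t * \<sigma> * (t * \<sigma> * ?q (?l s))\<bar> + 6 * \<bar>u (?l s)\<bar>)"
    by (rule hermite_derivative_bound)
       (intro partial_deriv_along_line diff DERIV_cmult continuous_intros ct)+
  also have "\<bar>t * \<sigma> * ?p (?l 0)\<bar> = t * \<bar>?p x\<bar>"
    using t by (simp add: abs_mult)
  also have "(\<lambda>s. \<bar>t * \<sigma> * (t * \<sigma> * ?q (?l s))\<bar> + 6 * \<bar>u (?l s)\<bar>)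
      = (\<lambda>s. t * (t * \<bar>?q (?l s)\<bar> + 6 / t * \<bar>u (?l s)\<bar>))"
    using t by (auto simp: abs_mult algebra_simps)
  finally have "\<bar>?p x\<bar> \<le> integral {0..1} (\<lambda>s. t * \<bar>?q (?l s)\<bar> + 6 / t * \<bar>u (?l s)\<bar>)"
    using t by simp
  from mult_left_mono[OF this c] show "c * \<bar>?p x\<bar> \<le> integral {0..1} (\<lambda>s. h (?l s))"
    unfolding h_def by simp
qed

text \<open>
  The segment used at \<open>x\<close> depends on the sign of \<open>x $ i\<close>. Bounding by the sum of the averages in both
  orientations removes this dependence, so that translation invariance applies to each of them; this
  accounts for one factor \<open>2\<close>, the weight for the other.
\<close>

lemma partial_deriv_gauss_modular:
  fixes u :: "real ^ 'n::finite \<Rightarrow> real"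
  assumes u: "u \<in> test_functions" and t: "0 < t" "t \<le> 1" and c: "0 \<le> c"
  shows "(\<integral>\<^sup>+ x. ennreal (M (c * \<bar>partial_deriv i u x\<bar>)) \<partial>gauss_measure)
    \<le> 4 * (\<integral>\<^sup>+ x. ennreal (M (c * (t * \<bar>partial_deriv i (partial_deriv i u) x\<bar> + 6 / t * \<bar>u x\<bar>)))
              \<partial>gauss_measure)"
proof -
  define h where "h x = c * (t * \<bar>partial_deriv i (partial_deriv i u) x\<bar> + 6 / t * \<bar>u x\<bar>)" for x
  define w :: "real ^ 'n \<Rightarrow> real" where "w x = exp (- (norm x)\<^sup>2 / 2)" for x
  define G where "G x = ennreal (M (h x)) * ennreal (w x)" for x
  define e :: "real ^ 'n" where "e = t *\<^sub>R axis i 1"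
  have cont: "continuous_on UNIV u" "continuous_on UNIV (partial_deriv i u)"
      "continuous_on UNIV (partial_deriv i (partial_deriv i u))"
    using test_function_partials[OF u, of "[]"] test_function_partials[OF u, of "[i]"]
      test_function_partials[OF u, of "[i, i]"] by auto
  have [measurable]: "(\<lambda>x. M (h x)) \<in> borel_measurable borel"
    unfolding h_def using t c by (intro measurable_comp continuous_intros cont) auto
  have [measurable]: "(\<lambda>x. M (c * \<bar>partial_deriv i u x\<bar>)) \<in> borel_measurable borel"
    using c by (intro measurable_comp continuous_intros cont) auto
  have [measurable]: "w \<in> borel_measurable borel"
    unfolding w_def by measurable
  have [measurable]: "G \<in> borel_measurable borel"
    unfolding G_def by measurable
  have [measurable]:
    "(\<lambda>x. \<integral>\<^sup>+ s. indicator {0..1} s * G (x + s *\<^sub>R d) \<partial>lborel) \<in> borel_measurable borel" for d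
    by measurable
  have point: "ennreal (M (c * \<bar>partial_deriv i u x\<bar>)) * ennreal (w x)
      \<le> 2 * ((\<integral>\<^sup>+ s. indicator {0..1} s * G (x + s *\<^sub>R e) \<partial>lborel)
           + (\<integral>\<^sup>+ s. indicator {0..1} s * G (x + s *\<^sub>R (- e)) \<partial>lborel))" for x
  proof -
    define \<sigma> :: real where "\<sigma> = (if 0 \<le> x $ i then - 1 else 1)"
    have l: "x + (s * (t * \<sigma>)) *\<^sub>R axis i 1 = x + s *\<^sub>R (\<sigma> *\<^sub>R e)" for s
      by (simp add: e_def mult_ac)
    have [measurable]: "(\<lambda>s. M (h (x + s *\<^sub>R (\<sigma> *\<^sub>R e)))) \<in> borel_measurable borel"
      by (rule measurable_compose[where g = "\<lambda>x. M (h x)" and N = borel]) measurable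
    have "ennreal (M (c * \<bar>partial_deriv i u x\<bar>)) * ennreal (w x)
        \<le> (\<integral>\<^sup>+ s. indicator {0..1} s * ennreal (M (h (x + s *\<^sub>R (\<sigma> *\<^sub>R e)))) \<partial>lborel) * ennreal (w x)"
      using partial_deriv_pointwise[OF u t(1) _ c, of \<sigma> i x]
      by (intro mult_right_mono) (auto simp: h_def \<sigma>_def l[unfolded \<sigma>_def])
    also have "\<dots> = (\<integral>\<^sup>+ s. indicator {0..1} s * ennreal (M (h (x + s *\<^sub>R (\<sigma> *\<^sub>R e)))) * ennreal (w x) \<partial>lborel)"
      by (rule nn_integral_multc[symmetric]) measurable
    also have "\<dots> \<le> (\<integral>\<^sup>+ s. 2 * (indicator {0..1} s * G (x + s *\<^sub>R (\<sigma> *\<^sub>R e))) \<partial>lborel)"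
    proof (intro nn_integral_mono)
      fix s :: real
      show "indicator {0..1} s * ennreal (M (h (x + s *\<^sub>R (\<sigma> *\<^sub>R e)))) * ennreal (w x)
          \<le> 2 * (indicator {0..1} s * G (x + s *\<^sub>R (\<sigma> *\<^sub>R e)))"
      proof (cases "s \<in> {0..1}")
        case True
        then have "w x \<le> 2 * w (x + (s * t * \<sigma>) *\<^sub>R axis i 1)"
          unfolding w_def using t
          by (intro gauss_weight_inward) (auto simp: \<sigma>_def mult_le_one)
        then have "ennreal (w x) \<le> 2 * ennreal (w (x + s *\<^sub>R (\<sigma> *\<^sub>R e)))"
          by (simp add: e_def mult_ac ennreal_leI flip: ennreal_mult' ennreal_numeral)
        from mult_left_mono[OF this, of "ennreal (M (h (x + s *\<^sub>R (\<sigma> *\<^sub>R e))))"]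
        show ?thesis
          using True by (simp add: G_def mult_ac)
      qed simp
    qed
    also have "\<dots> = 2 * (\<integral>\<^sup>+ s. indicator {0..1} s * G (x + s *\<^sub>R (\<sigma> *\<^sub>R e)) \<partial>lborel)"
      by (rule nn_integral_cmult) measurable
    also have "\<dots> \<le> 2 * ((\<integral>\<^sup>+ s. indicator {0..1} s * G (x + s *\<^sub>R e) \<partial>lborel)
           + (\<integral>\<^sup>+ s. indicator {0..1} s * G (x + s *\<^sub>R (- e)) \<partial>lborel))"
      by (intro mult_left_mono) (auto simp: \<sigma>_def)
    finally show ?thesis .
  qed
  have "(\<integral>\<^sup>+ x. ennreal (M (c * \<bar>partial_deriv i u x\<bar>)) \<partial>gauss_measure)
      = (\<integral>\<^sup>+ x. ennreal (M (c * \<bar>partial_deriv i u x\<bar>)) * ennreal (w x) \<partial>lborel)"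
    unfolding w_def by (rule nn_integral_gauss_measure) measurable
  also have "\<dots> \<le> (\<integral>\<^sup>+ x. 2 * ((\<integral>\<^sup>+ s. indicator {0..1} s * G (x + s *\<^sub>R e) \<partial>lborel)
           + (\<integral>\<^sup>+ s. indicator {0..1} s * G (x + s *\<^sub>R (- e)) \<partial>lborel)) \<partial>lborel)"
    by (intro nn_integral_mono point)
  also have "\<dots> = 2 * ((\<integral>\<^sup>+ x. G x \<partial>lborel) + (\<integral>\<^sup>+ x. G x \<partial>lborel))"
    by (simp add: nn_integral_cmult nn_integral_add nn_integral_translation_average
        del: scaleR_minus_right)
  also have "\<dots> = 4 * (\<integral>\<^sup>+ x. G x \<partial>lborel)"
    by (simp add: mult_2[symmetric] mult.assoc[symmetric] del: mult_2)
  also have "(\<integral>\<^sup>+ x. G x \<partial>lborel) = (\<integral>\<^sup>+ x. ennreal (M (h x)) \<partial>gauss_measure)"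
    unfolding G_def w_def by (rule nn_integral_gauss_measure[symmetric]) measurable
  finally show ?thesis
    unfolding h_def .
qed

text \<open>
  The Euclidean norm of the gradient is at most the mean over \<open>i\<close> of \<open>n * \<bar>\<partial>\<^sub>i u\<bar>\<close>. Taking the mean,
  rather than the sum, lets convexity pass \<open>M\<close> inside, and the \<open>n\<close> summands then contribute \<open>1 / n\<close> each.
\<close>

lemma gradient_gauss_modular:
  fixes u :: "real ^ 'n::finite \<Rightarrow> real"
  assumes u: "u \<in> test_functions" and t: "0 < t" "t \<le> 1" and c: "0 \<le> c"
  shows "(\<integral>\<^sup>+ x. ennreal (M (c * norm (gradient u x))) \<partial>gauss_measure)
    \<le> 4 * (\<integral>\<^sup>+ x. ennreal (M (real CARD('n) * c * (t * norm (hessian u x) + 6 / t * \<bar>u x\<bar>)))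
              \<partial>gauss_measure)"
    (is "_ \<le> 4 * ?R")
proof -
  define n where "n = real CARD('n)"
  have n: "0 < n"
    by (simp add: n_def)
  have meas: "(\<lambda>x. ennreal (M (n * c * \<bar>partial_deriv i u x\<bar>))) \<in> borel_measurable gauss_measure" for i
  proof -
    have "continuous_on UNIV (partial_deriv i u)"
      using test_function_partials(2)[OF u, of "[i]"] by simp
    then have "(\<lambda>x. M (n * c * \<bar>partial_deriv i u x\<bar>)) \<in> borel_measurable borel"
      using n c by (intro measurable_comp continuous_intros) auto
    then show ?thesis
      by (simp add: gauss_measure_def)
  qed
  have point: "ennreal (M (c * norm (gradient u x)))
      \<le> (\<Sum>i\<in>UNIV. ennreal (1 / n) * ennreal (M (n * c * \<bar>partial_deriv i u x\<bar>)))" for x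
  proof -
    have "c * norm (gradient u x) \<le> c * (\<Sum>i\<in>UNIV. \<bar>gradient u x $ i\<bar>)"
      using c by (intro mult_left_mono norm_le_l1_cart)
    also have "\<dots> = (\<Sum>i\<in>UNIV. (1 / n) *\<^sub>R (n * c * \<bar>partial_deriv i u x\<bar>))"
      using n by (simp add: gradient_def sum_distrib_left)
    finally have "M (c * norm (gradient u x))
        \<le> M (\<Sum>i\<in>UNIV. (1 / n) *\<^sub>R (n * c * \<bar>partial_deriv i u x\<bar>))"
      using c by (intro mono) auto
    also have "\<dots> \<le> (\<Sum>i\<in>UNIV. 1 / n * M (n * c * \<bar>partial_deriv i u x\<bar>))"
      using n c by (intro convex_on_sum[OF _ _ convex]) (auto simp: n_def)
    finally have "ennreal (M (c * norm (gradient u x)))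
        \<le> ennreal (\<Sum>i\<in>UNIV. 1 / n * M (n * c * \<bar>partial_deriv i u x\<bar>))"
      by (rule ennreal_leI)
    also have "\<dots> = (\<Sum>i\<in>UNIV. ennreal (1 / n) * ennreal (M (n * c * \<bar>partial_deriv i u x\<bar>)))"
      using n c by (subst sum_ennreal[symmetric])
        (auto simp del: times_divide_eq_left intro!: sum.cong ennreal_mult nonneg mult_nonneg_nonneg)
    finally show ?thesis .
  qed
  have each: "(\<integral>\<^sup>+ x. ennreal (M (n * c * \<bar>partial_deriv i u x\<bar>)) \<partial>gauss_measure) \<le> 4 * ?R" for i
  proof -
    have "(\<integral>\<^sup>+ x. ennreal (M (n * c * \<bar>partial_deriv i u x\<bar>)) \<partial>gauss_measure)
        \<le> 4 * (\<integral>\<^sup>+ x. ennreal (M (n * c * (t * \<bar>partial_deriv i (partial_deriv i u) x\<bar> + 6 / t * \<bar>u x\<bar>)))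
              \<partial>gauss_measure)"
      using n c by (intro partial_deriv_gauss_modular u t) simp
    also have "\<dots> \<le> 4 * ?R"
      using n c t unfolding n_def[symmetric]
      by (intro mult_left_mono nn_integral_mono ennreal_leI mono add_mono norm_hessian_ge) auto
    finally show ?thesis .
  qed
  have "(\<integral>\<^sup>+ x. ennreal (M (c * norm (gradient u x))) \<partial>gauss_measure)
      \<le> (\<integral>\<^sup>+ x. (\<Sum>i\<in>UNIV. ennreal (1 / n) * ennreal (M (n * c * \<bar>partial_deriv i u x\<bar>))) \<partial>gauss_measure)"
    by (intro nn_integral_mono point)
  also have "\<dots> = (\<Sum>i\<in>UNIV. ennreal (1 / n) * (\<integral>\<^sup>+ x. ennreal (M (n * c * \<bar>partial_deriv i u x\<bar>)) \<partial>gauss_measure))"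
    using meas by (subst nn_integral_sum) (auto simp: nn_integral_cmult)
  also have "\<dots> \<le> (\<Sum>i\<in>(UNIV :: 'n set). ennreal (1 / n) * (4 * ?R))"
    by (intro sum_mono mult_left_mono each) simp
  also have "\<dots> = (ennreal n * ennreal (1 / n)) * (4 * ?R)"
    by (simp add: n_def ennreal_of_nat_eq_real_of_nat mult.assoc)
  also have "ennreal n * ennreal (1 / n) = 1"
    using n by (simp flip: ennreal_mult')
  finally show ?thesis
    by simp
qed

end

section \<open>Luxemburg norms\<close>

context young_gauge
begin

lemma modular_finite:
  fixes f :: "real ^ 'n::finite \<Rightarrow> 'b::real_normed_vector"
  assumes f: "continuous_on UNIV f" and S: "compact S" "\<And>x. x \<notin> S \<Longrightarrow> f x = 0"
  shows "modular M gauss_measure f < \<infinity>"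
proof -
  have "bounded (f ` S)"
    using f S by (intro compact_imp_bounded compact_continuous_image) (auto intro: continuous_on_subset)
  then obtain B where B: "0 < B" "\<And>x. x \<in> S \<Longrightarrow> norm (f x) \<le> B"
    by (auto simp: bounded_pos)
  have [measurable]: "(\<lambda>x. M (norm (f x))) \<in> borel_measurable borel"
    by (intro measurable_comp continuous_intros f) auto
  have "modular M gauss_measure f
      = (\<integral>\<^sup>+ x. ennreal (M (norm (f x))) * ennreal (exp (- (norm x)\<^sup>2 / 2)) \<partial>lborel)"
    unfolding modular_def by (rule nn_integral_gauss_measure) measurable
  also have "\<dots> \<le> (\<integral>\<^sup>+ x. ennreal (M B) * indicator S x \<partial>lborel)"
  proof (rule nn_integral_mono)
    fix x
    have "ennreal (M (norm (f x))) \<le> ennreal (M B) * indicator S x"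
      using S(2)[of x] B by (auto simp: indicator_def zero intro!: ennreal_leI mono)
    moreover have "ennreal (exp (- (norm x)\<^sup>2 / 2)) \<le> 1"
      by (simp add: ennreal_le_1)
    ultimately have "ennreal (M (norm (f x))) * ennreal (exp (- (norm x)\<^sup>2 / 2))
        \<le> (ennreal (M B) * indicator S x) * 1"
      by (intro mult_mono) auto
    then show "ennreal (M (norm (f x))) * ennreal (exp (- (norm x)\<^sup>2 / 2))
        \<le> ennreal (M B) * indicator S x"
      by simp
  qed
  also have "\<dots> = ennreal (M B) * emeasure lborel S"
    using S(1) by (intro nn_integral_cmult_indicator) (auto simp: compact_imp_closed borel_closed)
  also have "\<dots> < \<infinity>"
    using emeasure_bounded_finite[OF compact_imp_bounded[OF S(1)]]
    by (simp add: ennreal_mult_less_top)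
  finally show ?thesis .
qed

text \<open>
  The infimum over an empty set of reals carries no information, so non-emptiness has to be
  established before the norm can be used. Since \<open>M (r / K) \<le> M r / K\<close> for \<open>K \<ge> 1\<close>, any \<open>K\<close> above both
  \<open>1\<close> and the modular works.
\<close>

lemma luxemburg_set_nonempty:
  assumes meas: "(\<lambda>x. M (norm (f x))) \<in> borel_measurable \<mu>" and fin: "modular M \<mu> f < \<infinity>"
  shows "\<exists>K>0. (\<integral>\<^sup>+ x. ennreal (M (norm (f x) / K)) \<partial>\<mu>) \<le> 1"
proof -
  define K where "K = max 1 (enn2real (modular M \<mu> f))"
  have K: "1 \<le> K"
    by (simp add: K_def)
  have "(\<integral>\<^sup>+ x. ennreal (M (norm (f x) / K)) \<partial>\<mu>)
      \<le> (\<integral>\<^sup>+ x. ennreal (1 / K) * ennreal (M (norm (f x))) \<partial>\<mu>)"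
  proof (rule nn_integral_mono)
    fix x
    show "ennreal (M (norm (f x) / K)) \<le> ennreal (1 / K) * ennreal (M (norm (f x)))"
      using K shrink[of "1 / K" "norm (f x)"] nonneg[of "norm (f x)"]
      by (simp flip: ennreal_mult add: ennreal_leI)
  qed
  also have "\<dots> = ennreal (1 / K) * modular M \<mu> f"
    unfolding modular_def using meas by (intro nn_integral_cmult) measurable
  also have "modular M \<mu> f = ennreal (enn2real (modular M \<mu> f))"
    using fin by (simp add: less_top)
  also have "\<dots> \<le> ennreal K"
    by (intro ennreal_leI) (simp add: K_def)
  also have "ennreal (1 / K) * ennreal K = 1"
    using K by (simp flip: ennreal_mult)
  finally show ?thesis
    using K by (intro exI[of _ K]) (auto simp: mult_left_mono)
qed

end

lemma luxemburg_norm_le: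
  assumes "0 < K" "(\<integral>\<^sup>+ x. ennreal (M (norm (f x) / K)) \<partial>\<mu>) \<le> 1"
  shows "luxemburg_norm M \<mu> f \<le> K"
  unfolding luxemburg_norm_def using assms by (intro cInf_lower bdd_belowI[of _ 0]) auto

lemma luxemburg_norm_nonneg:
  assumes "\<exists>K>0. (\<integral>\<^sup>+ x. ennreal (M (norm (f x) / K)) \<partial>\<mu>) \<le> 1"
  shows "0 \<le> luxemburg_norm M \<mu> f"
  unfolding luxemburg_norm_def using assms by (intro cInf_greatest) auto

lemma (in young_gauge) modular_le_1_above_luxemburg_norm:
  assumes ne: "\<exists>K>0. (\<integral>\<^sup>+ x. ennreal (M (norm (f x) / K)) \<partial>\<mu>) \<le> 1"
    and a: "luxemburg_norm M \<mu> f < a"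
  shows "(\<integral>\<^sup>+ x. ennreal (M (norm (f x) / a)) \<partial>\<mu>) \<le> 1"
proof -
  obtain K where K: "0 < K" "(\<integral>\<^sup>+ x. ennreal (M (norm (f x) / K)) \<partial>\<mu>) \<le> 1" "K < a"
    using cInf_lessD[OF _ a[unfolded luxemburg_norm_def]] ne by auto
  have "(\<integral>\<^sup>+ x. ennreal (M (norm (f x) / a)) \<partial>\<mu>) \<le> (\<integral>\<^sup>+ x. ennreal (M (norm (f x) / K)) \<partial>\<mu>)"
    using K by (intro nn_integral_mono ennreal_leI mono) (auto intro!: divide_left_mono)
  with K show ?thesis
    by simp
qed

section \<open>The interpolation inequalities\<close>

text \<open>
  The balance \<open>t = sqrt (x / y)\<close> is admissible only when \<open>0 < x \<le> y\<close>. For \<open>y \<le> x\<close> the choice \<open>t = 1\<close>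
  suffices, and for \<open>x = 0\<close> the bound is obtained as \<open>t\<close> tends to \<open>0\<close>.
\<close>

lemma optimise_interpolation:
  fixes x y z C :: real
  assumes C: "0 \<le> C" and nn: "0 \<le> x" "0 \<le> y"
    and le: "\<And>t. 0 < t \<Longrightarrow> t \<le> 1 \<Longrightarrow> z \<le> C * (t * y + x / t)"
  shows "z \<le> 2 * C * sqrt (y * x) + 2 * C * x"
proof -
  consider "y \<le> x" | "x = 0" "0 < y" | "0 < x" "x < y"
    using nn by linarith
  then show ?thesis
  proof cases
    case 1
    have "z \<le> C * (y + x)"
      using le[of 1] by simp
    also have "\<dots> \<le> C * (2 * x)"
      using 1 C by (intro mult_left_mono) auto
    finally show ?thesis
      using C nn by (simp add: add_increasing)
  next
    case 2
    have "z \<le> 0"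
    proof (rule tendsto_lowerbound)
      show "((\<lambda>t. C * (t * y)) \<longlongrightarrow> 0) (at_right 0)"
        by (auto intro!: tendsto_eq_intros)
      show "\<forall>\<^sub>F t in at_right 0. z \<le> C * (t * y)"
        using 2 le by (auto simp: eventually_at_right_field intro!: exI[of _ 1])
    qed simp
    then show ?thesis
      using 2 by simp
  next
    case 3
    define t where "t = sqrt (x / y)"
    have t: "0 < t" "t \<le> 1"
      using 3 by (auto simp: t_def)
    have "t * y = sqrt (y * x)" "x / t = sqrt (y * x)"
      using 3 by (auto simp: t_def real_sqrt_divide real_sqrt_mult field_simps)
    then have "z \<le> C * (2 * sqrt (y * x))"
      using le[OF t] by simp
    then show ?thesis
      using C nn by (simp add: add_increasing2)
  qed
qed

lemma (in young_gauge) Delta2_dilation: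
  assumes "Delta2 M" "0 \<le> c"
  shows "\<exists>D>0. \<forall>r\<ge>0. M (c * r) \<le> D * M r"
proof -
  obtain C where C: "1 < C" "\<And>r. 0 < r \<Longrightarrow> M (2 * r) \<le> C * M r"
    using assms by (auto simp: Delta2_def)
  have C2: "M (2 * r) \<le> C * M r" if "0 \<le> r" for r
    using C(2)[of r] that zero by (cases "r = 0") auto
  have pow: "M (2 ^ k * r) \<le> C ^ k * M r" if "0 \<le> r" for k r
  proof (induction k)
    case (Suc k)
    have "M (2 ^ Suc k * r) \<le> C * M (2 ^ k * r)"
      using C2[of "2 ^ k * r"] that by (simp add: mult_ac)
    also have "\<dots> \<le> C * (C ^ k * M r)"
      using Suc C(1) by (intro mult_left_mono) auto
    finally show ?case
      by simp
  qed simp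
  obtain k where k: "c < 2 ^ k"
    using real_arch_pow[of 2 c] by auto
  show ?thesis
  proof (intro exI[of _ "C ^ k"] conjI allI impI)
    fix r :: real
    assume r: "0 \<le> r"
    have "M (c * r) \<le> M (2 ^ k * r)"
      using assms(2) r k by (intro mono mult_right_mono) auto
    with pow[OF r, of k] show "M (c * r) \<le> C ^ k * M r"
      by simp
  qed (use C in auto)
qed

lemma N_function_young_gauge: "N_function M \<Longrightarrow> young_gauge M"
  by (simp add: N_function_def young_gauge_def)

context young_gauge
begin

lemma measurable_norm_comp:
  assumes "continuous_on UNIV f"
  shows "(\<lambda>x. M (norm (f x))) \<in> borel_measurable gauss_measure"
proof -
  have "(\<lambda>x. M (norm (f x))) \<in> borel_measurable borel"
    by (intro measurable_comp continuous_intros assms) auto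
  then show ?thesis
    by (simp add: gauss_measure_def)
qed

lemma luxemburg_set_nonempty_test:
  fixes f :: "real ^ 'n::finite \<Rightarrow> 'b::real_normed_vector"
  assumes "u \<in> test_functions" "continuous_on UNIV f" "\<And>x. x \<notin> closure {x. u x \<noteq> 0} \<Longrightarrow> f x = 0"
  shows "\<exists>K>0. (\<integral>\<^sup>+ x. ennreal (M (norm (f x) / K)) \<partial>gauss_measure) \<le> 1"
  using assms
  by (intro luxemburg_set_nonempty measurable_norm_comp modular_finite[of _ "closure {x. u x \<noteq> 0}"])
     (auto simp: test_functions_def)

lemma modular_interpolation:
  assumes "Delta2 M"
  shows "\<exists>C>0. \<forall>u\<in>(test_functions :: (real ^ 'n::finite \<Rightarrow> real) set).
    modular M gauss_measure (gradient u)
      \<le> ennreal C * modular M gauss_measure (hessian u) + ennreal C * modular M gauss_measure u"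
proof -
  define n where "n = real CARD('n)"
  obtain D where D: "0 < D" "\<And>r. 0 \<le> r \<Longrightarrow> M (12 * n * r) \<le> D * M r"
    using Delta2_dilation[OF assms, of "12 * n"] by (auto simp: n_def)
  show ?thesis
  proof (intro exI[of _ "4 * D"] conjI ballI)
    fix u :: "real ^ 'n \<Rightarrow> real"
    assume u: "u \<in> test_functions"
    have cu: "continuous_on UNIV u"
      using test_function_partials(2)[OF u, of "[]"] by simp
    have [measurable]: "(\<lambda>x. M (norm (u x))) \<in> borel_measurable gauss_measure"
      "(\<lambda>x. M (norm (hessian u x))) \<in> borel_measurable gauss_measure"
      by (intro measurable_norm_comp cu continuous_hessian u)+
    have split: "M (n * 1 * (1 * a + 6 / 1 * b)) \<le> D * M a + D * M b" if "0 \<le> a" "0 \<le> b" for a b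
    proof -
      have "M (n * 1 * (1 * a + 6 / 1 * b)) \<le> M ((1 - 1 / 2) * (12 * n * a) + 1 / 2 * (12 * n * b))"
        using that by (intro mono) (auto simp: n_def algebra_simps)
      also have "\<dots> \<le> (1 - 1 / 2) * M (12 * n * a) + 1 / 2 * M (12 * n * b)"
        using convex_onD[OF convex, of "1 / 2" "12 * n * a" "12 * n * b"] that by (simp add: n_def)
      also have "\<dots> \<le> D * M a + D * M b"
        using D(2)[OF that(1)] D(2)[OF that(2)] nonneg[of "12 * n * a"] nonneg[of "12 * n * b"] that
        by (simp add: n_def)
      finally show ?thesis .
    qed
    have "modular M gauss_measure (gradient u)
        \<le> 4 * (\<integral>\<^sup>+ x. ennreal (M (n * 1 * (1 * norm (hessian u x) + 6 / 1 * \<bar>u x\<bar>))) \<partial>gauss_measure)"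
      using gradient_gauss_modular[OF u, of 1 1] by (simp add: modular_def n_def)
    also have "\<dots> \<le> 4 * (\<integral>\<^sup>+ x. ennreal D * ennreal (M (norm (hessian u x)))
        + ennreal D * ennreal (M (norm (u x))) \<partial>gauss_measure)"
    proof (intro mult_left_mono nn_integral_mono)
      fix x
      have "ennreal (M (n * 1 * (1 * norm (hessian u x) + 6 / 1 * \<bar>u x\<bar>)))
          \<le> ennreal (D * M (norm (hessian u x)) + D * M (norm (u x)))"
        using split[of "norm (hessian u x)" "\<bar>u x\<bar>"] by (intro ennreal_leI) simp
      then show "ennreal (M (n * 1 * (1 * norm (hessian u x) + 6 / 1 * \<bar>u x\<bar>)))
          \<le> ennreal D * ennreal (M (norm (hessian u x))) + ennreal D * ennreal (M (norm (u x)))"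
        using D(1) nonneg by (simp add: ennreal_mult)
    qed simp
    also have "\<dots> = 4 * (ennreal D * modular M gauss_measure (hessian u)
        + ennreal D * modular M gauss_measure u)"
      unfolding modular_def by (subst nn_integral_add) (auto simp: nn_integral_cmult simp del: real_norm_def)
    also have "\<dots> = ennreal (4 * D) * modular M gauss_measure (hessian u)
        + ennreal (4 * D) * modular M gauss_measure u"
      using D(1) by (simp add: ennreal_mult distrib_left mult.assoc)
    finally show "modular M gauss_measure (gradient u)
        \<le> ennreal (4 * D) * modular M gauss_measure (hessian u)
          + ennreal (4 * D) * modular M gauss_measure u" .
  qed (use D in auto)
qed

text \<open>
  The constant \<open>K\<close> is chosen so that \<open>n * (t * \<bar>\<nabla>\<^sup>2 u\<bar> + 6 / t * \<bar>u\<bar>) / K\<close> is exactly one quarter of a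
  convex combination, with weights \<open>1 - l\<close> and \<open>l\<close>, of \<open>\<bar>\<nabla>\<^sup>2 u\<bar> / a\<close> and \<open>\<bar>u\<bar> / b\<close>. The quarter cancels the
  constant of \<open>gradient_gauss_modular\<close> because \<open>M (r / 4) \<le> M r / 4\<close>.
\<close>

lemma luxemburg_interpolation_scaled:
  fixes u :: "real ^ 'n::finite \<Rightarrow> real"
  assumes u: "u \<in> test_functions" and t: "0 < t" "t \<le> 1"
    and a: "0 < a" "(\<integral>\<^sup>+ x. ennreal (M (norm (hessian u x) / a)) \<partial>gauss_measure) \<le> 1"
    and b: "0 < b" "(\<integral>\<^sup>+ x. ennreal (M (norm (u x) / b)) \<partial>gauss_measure) \<le> 1"
  shows "luxemburg_norm M gauss_measure (gradient u) \<le> 24 * real CARD('n) * (t * a + b / t)"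
proof -
  define n where "n = real CARD('n)"
  have n: "0 < n"
    by (simp add: n_def)
  define K where "K = 4 * n * (t * a + 6 / t * b)"
  define l where "l = (24 * n * b / t) / K"
  have K: "0 < K"
    using n t a b by (simp add: K_def add_pos_pos)
  have "K = 4 * n * t * a + 24 * n * b / t"
    by (simp add: K_def algebra_simps)
  moreover have "l * K = 24 * n * b / t"
    using K by (simp add: l_def)
  moreover have "(1 - l) * K = K - l * K"
    by (simp add: left_diff_distrib)
  ultimately have "(1 - l) * K = 4 * n * t * a"
    by linarith
  then have l: "0 \<le> l" "1 - l = 4 * n * t * a / K"
    using n t b K by (simp_all add: l_def field_simps)
  have "0 \<le> 1 - l"
    unfolding l(2) using n t a K by simp
  then have l1: "l \<le> 1"
    by simp
  have cu: "continuous_on UNIV u"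
    using test_function_partials(2)[OF u, of "[]"] by simp
  have cont: "continuous_on UNIV (\<lambda>x. hessian u x /\<^sub>R a)" "continuous_on UNIV (\<lambda>x. u x /\<^sub>R b)"
    by (intro continuous_intros cu continuous_hessian u)+
  have [measurable]: "(\<lambda>x. M (norm (u x) / b)) \<in> borel_measurable gauss_measure"
    "(\<lambda>x. M (norm (hessian u x) / a)) \<in> borel_measurable gauss_measure"
    using measurable_norm_comp[OF cont(1)] measurable_norm_comp[OF cont(2)] a(1) b(1)
    by (simp_all add: divide_inverse_commute abs_mult)
  have point: "M (n * (1 / K) * (t * p + 6 / t * q)) \<le> (1 - l) / 4 * M (p / a) + l / 4 * M (q / b)"
    if "0 \<le> p" "0 \<le> q" for p q
  proof -
    have "(1 - l) * (p / a) = 4 * n * t * p / K"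
      unfolding l(2) using a(1) by simp
    moreover have "l * (q / b) = 24 * n * q / (t * K)"
      unfolding l_def using b(1) by simp
    moreover have "n * (1 / K) * (t * p + 6 / t * q) = 1 / 4 * (4 * n * t * p / K + 24 * n * q / (t * K))"
      using t(1) K by (simp add: field_simps)
    ultimately have split: "n * (1 / K) * (t * p + 6 / t * q) = 1 / 4 * ((1 - l) * (p / a) + l * (q / b))"
      by (simp only:)
    have "M (n * (1 / K) * (t * p + 6 / t * q)) \<le> 1 / 4 * M ((1 - l) * (p / a) + l * (q / b))"
      unfolding split using that a(1) b(1) l(1) l1
      by (intro shrink add_nonneg_nonneg mult_nonneg_nonneg) auto
    also have "\<dots> \<le> 1 / 4 * ((1 - l) * M (p / a) + l * M (q / b))"
      using convex_onD[OF convex l(1) l1, of "p / a" "q / b"] that a(1) b(1)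
      by (intro mult_left_mono) auto
    also have "\<dots> = (1 - l) / 4 * M (p / a) + l / 4 * M (q / b)"
      by (simp add: field_simps)
    finally show ?thesis .
  qed
  have "(\<integral>\<^sup>+ x. ennreal (M (norm (gradient u x) / K)) \<partial>gauss_measure)
      \<le> 4 * (\<integral>\<^sup>+ x. ennreal (M (n * (1 / K) * (t * norm (hessian u x) + 6 / t * \<bar>u x\<bar>))) \<partial>gauss_measure)"
    using gradient_gauss_modular[OF u t, of "1 / K"] K by (simp add: n_def)
  also have "\<dots> \<le> 4 * (\<integral>\<^sup>+ x. ennreal ((1 - l) / 4) * ennreal (M (norm (hessian u x) / a))
      + ennreal (l / 4) * ennreal (M (norm (u x) / b)) \<partial>gauss_measure)"
  proof (intro mult_left_mono nn_integral_mono)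
    fix x
    have "ennreal (M (n * (1 / K) * (t * norm (hessian u x) + 6 / t * \<bar>u x\<bar>)))
        \<le> ennreal ((1 - l) / 4 * M (norm (hessian u x) / a) + l / 4 * M (norm (u x) / b))"
      using point[of "norm (hessian u x)" "\<bar>u x\<bar>"] by (intro ennreal_leI) simp
    also have "\<dots> = ennreal ((1 - l) / 4 * M (norm (hessian u x) / a)) + ennreal (l / 4 * M (norm (u x) / b))"
      using l(1) l1 a(1) b(1) by (intro ennreal_plus mult_nonneg_nonneg nonneg) auto
    also have "\<dots> = ennreal ((1 - l) / 4) * ennreal (M (norm (hessian u x) / a))
        + ennreal (l / 4) * ennreal (M (norm (u x) / b))"
      using l(1) l1 a(1) b(1) by (intro arg_cong2[where f = "(+)"] ennreal_mult nonneg) auto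
    finally show "ennreal (M (n * (1 / K) * (t * norm (hessian u x) + 6 / t * \<bar>u x\<bar>)))
        \<le> ennreal ((1 - l) / 4) * ennreal (M (norm (hessian u x) / a))
          + ennreal (l / 4) * ennreal (M (norm (u x) / b))" .
  qed simp
  also have "\<dots> = 4 * (ennreal ((1 - l) / 4) * (\<integral>\<^sup>+ x. ennreal (M (norm (hessian u x) / a)) \<partial>gauss_measure)
      + ennreal (l / 4) * (\<integral>\<^sup>+ x. ennreal (M (norm (u x) / b)) \<partial>gauss_measure))"
    by (subst nn_integral_add) (auto simp: nn_integral_cmult simp del: real_norm_def)
  also have "\<dots> \<le> 4 * (ennreal ((1 - l) / 4) * 1 + ennreal (l / 4) * 1)"
    by (intro mult_left_mono add_mono a b) auto
  also have "\<dots> = ennreal (4 * ((1 - l) / 4 + l / 4))"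
    using l(1) l1 by (subst ennreal_mult) (auto simp flip: ennreal_plus)
  also have "\<dots> = 1"
    by (simp add: field_simps)
  finally have "luxemburg_norm M gauss_measure (gradient u) \<le> K"
    using K by (intro luxemburg_norm_le)
  also have "K \<le> 24 * n * (t * a + b / t)"
    using n t a b by (simp add: K_def field_simps)
  finally show ?thesis
    by (simp add: n_def)
qed

text \<open>
  The norms themselves may be \<open>0\<close>, where dividing by them is meaningless; the scaled estimate is
  therefore used with \<open>a\<close> and \<open>b\<close> exceeding the norms by \<open>d > 0\<close>, and \<open>d\<close> then tends to \<open>0\<close>.
\<close>

lemma luxemburg_interpolation:
  fixes u :: "real ^ 'n::finite \<Rightarrow> real"
  assumes u: "u \<in> test_functions"
  shows "luxemburg_norm M gauss_measure (gradient u)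
    \<le> 48 * real CARD('n) * sqrt (luxemburg_norm M gauss_measure (hessian u) * luxemburg_norm M gauss_measure u)
      + 48 * real CARD('n) * luxemburg_norm M gauss_measure u"
proof -
  define C where "C = 24 * real CARD('n)"
  let ?N = "luxemburg_norm M gauss_measure"
  have C: "0 < C"
    by (simp add: C_def)
  have cu: "continuous_on UNIV u"
    using test_function_partials(2)[OF u, of "[]"] by simp
  have ne: "\<exists>K>0. (\<integral>\<^sup>+ x. ennreal (M (norm (u x) / K)) \<partial>gauss_measure) \<le> 1"
    "\<exists>K>0. (\<integral>\<^sup>+ x. ennreal (M (norm (hessian u x) / K)) \<partial>gauss_measure) \<le> 1"
    by (rule luxemburg_set_nonempty_test[OF u]; rule cu continuous_hessian[OF u] test_function_derivs_support; assumption?)+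
  note nn = ne[THEN luxemburg_norm_nonneg]
  have "luxemburg_norm M gauss_measure (gradient u) \<le> C * (t * ?N (hessian u) + ?N u / t)"
    if t: "0 < t" "t \<le> 1" for t
  proof (rule tendsto_lowerbound)
    show "((\<lambda>d. C * (t * (?N (hessian u) + d) + (?N u + d) / t))
        \<longlongrightarrow> C * (t * ?N (hessian u) + ?N u / t)) (at_right 0)"
      using t by (auto intro!: tendsto_eq_intros)
    have "?N (gradient u) \<le> C * (t * (?N (hessian u) + d) + (?N u + d) / t)" if "0 < d" for d
      unfolding C_def using that nn
      by (intro luxemburg_interpolation_scaled[OF u t] modular_le_1_above_luxemburg_norm ne) auto
    then show "\<forall>\<^sub>F d in at_right 0. ?N (gradient u) \<le> C * (t * (?N (hessian u) + d) + (?N u + d) / t)"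
      by (auto simp: eventually_at_right_field intro!: exI[of _ 1])
  qed simp
  from optimise_interpolation[OF _ nn(1) nn(2) this] C show ?thesis
    by (simp add: C_def)
qed

end

theorem corollary4p1:
  fixes M :: "real \<Rightarrow> real"
  assumes "N_function M"
    and "M differentiable_on {0..}"
    and "Delta2 M"
    and "mono_on {0<..} (\<lambda>r. M r / r\<^sup>2)"
  shows "(\<exists>C1>0. \<exists>C2>0. \<forall>u \<in> (test_functions :: (real ^ 'n::finite \<Rightarrow> real) set).
            modular M gauss_measure (gradient u)
              \<le> ennreal C1 * modular M gauss_measure (hessian u)
                + ennreal C2 * modular M gauss_measure u)
       \<and> (\<exists>C1>0. \<exists>C2>0. \<forall>u \<in> (test_functions :: (real ^ 'n \<Rightarrow> real) set).
            luxemburg_norm M gauss_measure (gradient u)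
              \<le> C1 * sqrt (luxemburg_norm M gauss_measure (hessian u)
                            * luxemburg_norm M gauss_measure u)
                + C2 * luxemburg_norm M gauss_measure u)"
proof -
  interpret young_gauge M
    using assms(1) by (rule N_function_young_gauge)
  show ?thesis
  proof
    show "\<exists>C1>0. \<exists>C2>0. \<forall>u \<in> (test_functions :: (real ^ 'n \<Rightarrow> real) set).
            modular M gauss_measure (gradient u)
              \<le> ennreal C1 * modular M gauss_measure (hessian u)
                + ennreal C2 * modular M gauss_measure u"
      using modular_interpolation[OF assms(3)] by blast
    show "\<exists>C1>0. \<exists>C2>0. \<forall>u \<in> (test_functions :: (real ^ 'n \<Rightarrow> real) set).
            luxemburg_norm M gauss_measure (gradient u)
              \<le> C1 * sqrt (luxemburg_norm M gauss_measure (hessian u)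
                            * luxemburg_norm M gauss_measure u)
                + C2 * luxemburg_norm M gauss_measure u"
      by (intro exI[of _ "48 * real CARD('n)"] conjI ballI luxemburg_interpolation) auto
  qed
qed

end
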